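(* Let $f:[0,1]\to[0,1]$ be given by $f(\Delta^{3}_{\alpha_1\alpha_2\ldots\alpha_n\ldots})=\Delta^{3}_{\varphi(\alpha_1)\varphi(\alpha_2)\ldots\varphi(\alpha_n)\ldots}$, where $\varphi(0)=0$, $\varphi(1)=2$, $\varphi(2)=1$. Then $f$ is nowhere differentiable, i.e. there is no point of $[0,1]$ at which $f$ is differentiable.
   Context: For digits $\alpha_n\in\{0,1,2\}$, $\Delta^{3}_{\alpha_1\alpha_2\ldots\alpha_n\ldots}$ denotes $\sum_{n=1}^{\infty}\alpha_n 3^{-n}$. Every $x\in[0,1]$ is written using its ternary representation that does not end in an infinite string of 2's, except that $1$ is written as $\Delta^{3}_{222\ldots}$; thus each $x$ has exactly one admissible digit sequence, and it is this sequence that is used in the definition of $f$. Differentiability is that of a function with domain $[0,1]$ (one-sided at the endpoints). *)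

theory Defs
  imports "HOL-Analysis.Analysis"
begin

text \<open>Digit sequences are indexed from 0, so the digit at index \<open>n\<close> has weight \<open>3 ^ -(n + 1)\<close>.\<close>

definition ternary_value :: "(nat \<Rightarrow> nat) \<Rightarrow> real" where
  "ternary_value a = (\<Sum>n. real (a n) / 3 ^ Suc n)"

text \<open>A sequence ending in an infinite string of 2's is only allowed if all its digits are 2;
  this is the representation of the number 1.\<close>

definition admissible_digits :: "(nat \<Rightarrow> nat) \<Rightarrow> bool" where
  "admissible_digits a \<longleftrightarrow> (\<forall>n. a n \<in> {0, 1, 2}) \<and>
     (\<not> (\<exists>N. \<forall>n\<ge>N. a n = 2) \<or> (\<forall>n. a n = 2))"

text \<open>Well-defined for \<open>x\<close> in the unit interval, see \<open>ex1_ternary_digits\<close> below.\<close>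

definition ternary_digits :: "real \<Rightarrow> nat \<Rightarrow> nat" where
  "ternary_digits x = (THE a. admissible_digits a \<and> ternary_value a = x)"

text \<open>Only the values at the digits 0, 1, 2 matter.\<close>

definition \<phi> :: "nat \<Rightarrow> nat" where
  "\<phi> d = (if d = 1 then 2 else if d = 2 then 1 else 0)"

definition digit_swap :: "real \<Rightarrow> real" where
  "digit_swap x = ternary_value (\<lambda>n. \<phi> (ternary_digits x n))"

lemma summable_two: "summable (\<lambda>n. 2 / 3 ^ Suc n :: real)"
  and suminf_two: "(\<Sum>n. 2 / 3 ^ Suc n :: real) = 1"
proof -
  have "(\<lambda>n. (2/3) * (1/3) ^ n :: real) sums ((2/3) * (1 / (1 - 1/3)))"
    by (intro sums_mult geometric_sums) auto
  moreover have "(\<lambda>n. (2/3) * (1/3) ^ n :: real) = (\<lambda>n. 2 / 3 ^ Suc n)"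
    by (simp add: fun_eq_iff power_divide)
  ultimately have "(\<lambda>n. 2 / 3 ^ Suc n :: real) sums 1" by simp
  then show "summable (\<lambda>n. 2 / 3 ^ Suc n :: real)" "(\<Sum>n. 2 / 3 ^ Suc n :: real) = 1"
    by (auto simp: sums_iff)
qed

lemma summable_ternary:
  assumes "\<And>n. a n \<le> (2::nat)"
  shows "summable (\<lambda>n. real (a n) / 3 ^ Suc n)"
proof (rule summable_comparison_test[OF _ summable_two], intro exI[of _ 0] allI impI)
  fix n show "norm (real (a n) / 3 ^ Suc n) \<le> 2 / 3 ^ Suc n"
    using assms[of n] by (simp add: field_simps)
qed

lemma ternary_value_nonneg:
  assumes "\<And>n. a n \<le> 2"
  shows "0 \<le> ternary_value a"
  unfolding ternary_value_def by (intro suminf_nonneg summable_ternary assms) auto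

lemma ternary_value_le_1:
  assumes "\<And>n. a n \<le> 2"
  shows "ternary_value a \<le> 1"
  unfolding ternary_value_def suminf_two[symmetric]
  by (intro suminf_le summable_ternary summable_two assms divide_right_mono) (use assms in auto)

lemma ternary_value_less_1:
  assumes "\<And>n. a n \<le> 2" "a m \<noteq> 2"
  shows "ternary_value a < 1"
proof -
  have le: "0 \<le> 2 / 3 ^ Suc n - real (a n) / 3 ^ Suc n" for n
    using assms(1)[of n] by (simp add: field_simps)
  have "a m < 2" using assms by (simp add: le_neq_implies_less)
  then have "0 < 2 / 3 ^ Suc m - real (a m) / 3 ^ Suc m"
    by (simp add: field_simps)
  then have "0 < (\<Sum>n. 2 / 3 ^ Suc n - real (a n) / 3 ^ Suc n)"
    by (intro suminf_pos2[OF summable_diff[OF summable_two summable_ternary[OF assms(1)]] le])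
  also have "\<dots> = 1 - ternary_value a"
    unfolding ternary_value_def
    using suminf_diff[OF summable_two summable_ternary[OF assms(1)]] suminf_two by simp
  finally show ?thesis by simp
qed

lemma ternary_value_rec:
  assumes "\<And>n. a n \<le> 2"
  shows "3 * ternary_value a = real (a 0) + ternary_value (\<lambda>k. a (Suc k))"
proof -
  have "ternary_value a = real (a 0) / 3 + (\<Sum>n. real (a (Suc n)) / 3 ^ Suc (Suc n))"
    unfolding ternary_value_def
    using suminf_split_head[OF summable_ternary[of a, OF assms]] by simp
  also have "(\<Sum>n. real (a (Suc n)) / 3 ^ Suc (Suc n))
      = (\<Sum>n. (real (a (Suc n)) / 3 ^ Suc n) / 3)"
    by (simp add: field_simps)
  also have "\<dots> = ternary_value (\<lambda>k. a (Suc k)) / 3"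
    unfolding ternary_value_def by (rule suminf_divide) (rule summable_ternary[OF assms])
  finally show ?thesis by simp
qed

lemma ternary_digits_unique:
  assumes "\<And>n. a n \<le> 2" "\<And>n. b n \<le> 2"
    and "\<And>N. \<exists>n\<ge>N. a n \<noteq> 2" "\<And>N. \<exists>n\<ge>N. b n \<noteq> 2"
    and "ternary_value a = ternary_value b"
  shows "a n = b n"
  using assms
proof (induction n arbitrary: a b)
  have shift: "\<exists>n\<ge>N. c (Suc n) \<noteq> 2" if "\<And>N. \<exists>n\<ge>N. c n \<noteq> 2" for c :: "nat \<Rightarrow> nat" and N
    using that[of "Suc N"] Suc_le_D by blast
  have head: "real (c 0) = of_int \<lfloor>3 * ternary_value c\<rfloor>"
    if c: "\<And>n. c n \<le> 2" "\<And>N. \<exists>n\<ge>N. c n \<noteq> 2" for c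
  proof -
    obtain m where "c (Suc m) \<noteq> 2" using shift[OF c(2)] by blast
    then have "ternary_value (\<lambda>k. c (Suc k)) < 1" using c by (intro ternary_value_less_1) auto
    moreover have "0 \<le> ternary_value (\<lambda>k. c (Suc k))" using c by (intro ternary_value_nonneg)
    ultimately have "\<lfloor>3 * ternary_value c\<rfloor> = int (c 0)"
      unfolding ternary_value_rec[OF c(1)] by (simp add: floor_unique)
    then show ?thesis by simp
  qed
  {
    case 0
    then show ?case using head[of a] head[of b] by simp
  next
    case (Suc n)
    have "a 0 = b 0" using head[of a] head[of b] Suc.prems by simp
    then have "ternary_value (\<lambda>k. a (Suc k)) = ternary_value (\<lambda>k. b (Suc k))"
      using ternary_value_rec[of a] ternary_value_rec[of b] Suc.prems by simp
    then show ?case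
      using Suc.IH[of "\<lambda>k. a (Suc k)" "\<lambda>k. b (Suc k)"] Suc.prems(1,2) shift[OF Suc.prems(3)]
        shift[OF Suc.prems(4)] by simp
  }
qed

lemma ternary_digits_exist:
  assumes x: "0 \<le> x" "x < 1"
  obtains a where "\<And>n. a n \<le> 2" "\<And>N. \<exists>n\<ge>N. a n \<noteq> 2" "ternary_value a = x"
proof -
  define r where "r n = frac (3 ^ n * x)" for n
  define a where "a n = nat \<lfloor>3 * r n\<rfloor>" for n
  have r: "0 \<le> r n" "r n < 1" for n by (auto simp: r_def frac_lt_1)
  have a2: "a n \<le> 2" for n
    using r[of n] unfolding a_def by linarith
  have a_eq: "real (a n) = of_int \<lfloor>3 * r n\<rfloor>" for n
    using r[of n] by (simp add: a_def)
  have rec: "3 * r n = real (a n) + r (Suc n)" for n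
  proof -
    have "3 * r n = 3 ^ Suc n * x - of_int (3 * \<lfloor>3 ^ n * x\<rfloor>)"
      by (simp add: r_def frac_def algebra_simps)
    then have "frac (3 * r n) = r (Suc n)"
      unfolding r_def frac_def by (simp only: floor_diff_of_int)
    then show ?thesis unfolding a_eq by (simp add: frac_def)
  qed
  have part: "(\<Sum>k<n. real (a (m + k)) / 3 ^ Suc k) = r m - r (m + n) / 3 ^ n" for m n
  proof (induction n)
    case (Suc n)
    then show ?case using rec[of "m + n"] by (simp add: field_simps)
  qed simp
  have "(\<lambda>n. r (m + n) / 3 ^ n) \<longlonglongrightarrow> 0" for m
  proof (rule tendsto_sandwich[OF _ _ tendsto_const])
    show "(\<lambda>n. (1/3 :: real) ^ n) \<longlonglongrightarrow> 0" by (rule LIMSEQ_realpow_zero) auto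
    show "\<forall>\<^sub>F n in sequentially. r (m + n) / 3 ^ n \<le> (1/3) ^ n"
      using r(2) by (auto simp: power_divide field_simps less_imp_le)
    show "\<forall>\<^sub>F n in sequentially. 0 \<le> r (m + n) / 3 ^ n"
      using r(1) by auto
  qed
  then have "(\<lambda>n. r m - r (m + n) / 3 ^ n) \<longlonglongrightarrow> r m - 0" for m
    by (intro tendsto_intros)
  then have val: "ternary_value (\<lambda>k. a (m + k)) = r m" for m
    unfolding ternary_value_def by (intro sums_unique[symmetric]) (simp add: sums_def part del: power_Suc)
  have nontriv: "\<exists>n\<ge>N. a n \<noteq> 2" for N
  proof (rule ccontr)
    assume "\<not> ?thesis"
    then have "ternary_value (\<lambda>k. a (N + k)) = 1"
      unfolding ternary_value_def using suminf_two by simp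
    then show False using val[of N] r(2)[of N] by simp
  qed
  have "ternary_value a = x"
    using val[of 0] x by (simp add: r_def frac_eq)
  with a2 nontriv show thesis by (rule that)
qed

lemma ex1_ternary_digits:
  assumes "x \<in> {0..1}"
  shows "\<exists>!a. admissible_digits a \<and> ternary_value a = x"
proof -
  have le2: "a n \<le> 2" if "admissible_digits a" for a n
  proof -
    have "a n \<in> {0, 1, 2}" using that by (simp add: admissible_digits_def)
    then show ?thesis by auto
  qed
  have two: "ternary_value (\<lambda>_. 2) = 1" using suminf_two by (simp add: ternary_value_def)
  show ?thesis
  proof (cases "x = 1")
    case True
    have "a = (\<lambda>_. 2)" if "admissible_digits a" "ternary_value a = 1" for a
      using ternary_value_less_1[OF le2[OF that(1)]] that(2) by fastforce
    with two show ?thesis unfolding True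
      by (intro ex1I[of _ "\<lambda>_. 2"]) (auto simp: admissible_digits_def)
  next
    case False
    then have x: "0 \<le> x" "x < 1" using assms by auto
    have inf: "\<exists>n\<ge>N. a n \<noteq> 2" if "admissible_digits a" "ternary_value a = x" for a N
    proof -
      have "\<not> (\<forall>n. a n = 2)"
      proof
        assume "\<forall>n. a n = 2"
        then have "a = (\<lambda>_. 2)" by auto
        then show False using that(2) two False by simp
      qed
      then show ?thesis using that(1) unfolding admissible_digits_def by blast
    qed
    obtain a where a: "\<And>n. a n \<le> 2" "\<And>N. \<exists>n\<ge>N. a n \<noteq> 2" "ternary_value a = x"
      using ternary_digits_exist[OF x] by blast
    have "a n \<in> {0, 1, 2}" for n using a(1)[of n] by auto
    with a(2) have adm: "admissible_digits a" unfolding admissible_digits_def by blast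
    show ?thesis
    proof (rule ex1I[of _ a])
      show "admissible_digits a \<and> ternary_value a = x" using adm a(3) by simp
      fix b assume b: "admissible_digits b \<and> ternary_value b = x"
      show "b = a"
        using ternary_digits_unique[of b a] a b le2 inf by (intro ext) simp
    qed
  qed
qed

lemma digit_swap_ternary_value:
  assumes "admissible_digits a"
  shows "digit_swap (ternary_value a) = ternary_value (\<lambda>n. \<phi> (a n))"
proof -
  have "a n \<le> 2" for n
  proof -
    have "a n \<in> {0, 1, 2}" using assms by (simp add: admissible_digits_def)
    then show ?thesis by auto
  qed
  then have "ternary_value a \<in> {0..1}"
    using ternary_value_nonneg ternary_value_le_1 by simp
  then have "ternary_digits (ternary_value a) = a"
    unfolding ternary_digits_def using assms by (intro the1_equality ex1_ternary_digits) auto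
  then show ?thesis by (simp add: digit_swap_def)
qed

lemma digit_swap_in_unit_interval: "digit_swap x \<in> {0..1}"
  unfolding digit_swap_def by (auto simp: \<phi>_def intro!: ternary_value_nonneg ternary_value_le_1)

end

theory Submission
  imports Defs
begin

text \<open>
  Replacing the digit \<open>a\<close> of \<open>x\<close> at one position by \<open>d\<close> yields a secant of slope
  \<open>(\<phi> d - \<phi> a) / (d - a)\<close>, whatever the position. For each \<open>a\<close> the two possible choices
  of \<open>d\<close> give different slopes, so that arbitrarily close to \<open>x\<close> there are secants whose
  slopes differ by a fixed amount. Only at \<open>x = 1\<close> does such a replacement leave the admissible
  sequences; there one uses the points with digits \<open>2\<dots>2000\<dots>\<close> and \<open>2\<dots>2100\<dots>\<close>, whose
  secants have slopes \<open>1/2\<close> and \<open>-1/4\<close>.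
\<close>

text \<open>With a derivative D, both quotients would lie within c / 2 of D near x, hence less than
  c apart. Nothing is asked about the sides of x on which y and z lie, so endpoints are covered
  too.\<close>

lemma not_differentiable_if_slopes_apart:
  fixes f :: "real \<Rightarrow> real"
  assumes c: "0 < c"
    and ex: "\<And>e. 0 < e \<Longrightarrow> \<exists>y\<in>S - {x}. \<exists>z\<in>S - {x}. dist y x < e \<and> dist z x < e \<and>
      c \<le> \<bar>(f y - f x) / (y - x) - (f z - f x) / (z - x)\<bar>"
  shows "\<not> f differentiable (at x within S)"
proof
  assume "f differentiable (at x within S)"
  then obtain D where "(f has_real_derivative D) (at x within S)"
    by (auto simp: real_differentiable_def)
  then have "((\<lambda>y. (f y - f x) / (y - x)) \<longlongrightarrow> D) (at x within S)"
    by (simp add: has_field_derivative_iff)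
  then have "\<forall>\<^sub>F y in at x within S. dist ((f y - f x) / (y - x)) D < c / 2"
    by (rule tendstoD) (use c in simp)
  then obtain e where "0 < e"
    and e: "\<And>y. y \<in> S \<Longrightarrow> y \<noteq> x \<Longrightarrow> dist y x < e \<Longrightarrow> dist ((f y - f x) / (y - x)) D < c / 2"
    unfolding eventually_at by blast
  from ex[OF \<open>0 < e\<close>] obtain y z where
    "y \<in> S - {x}" "z \<in> S - {x}" "dist y x < e" "dist z x < e"
    and sep: "c \<le> \<bar>(f y - f x) / (y - x) - (f z - f x) / (z - x)\<bar>"
    by blast
  then have "dist ((f y - f x) / (y - x)) D < c / 2" "dist ((f z - f x) / (z - x)) D < c / 2"
    using e by auto
  with sep show False unfolding dist_real_def by linarith
qed

text \<open>By \<open>ternary_value_rec\<close>, each common leading digit cancels in the difference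
  and leaves a factor 1/3. The induction passes to the shifted sequences, so both must be
  arbitrary.\<close>

lemma ternary_value_diff_shift:
  assumes "\<And>k. a k \<le> 2" "\<And>k. b k \<le> 2" "\<And>k. k < n \<Longrightarrow> a k = b k"
  shows "ternary_value b - ternary_value a
    = (ternary_value (\<lambda>k. b (n + k)) - ternary_value (\<lambda>k. a (n + k))) / 3 ^ n"
  using assms
proof (induction n arbitrary: a b)
  case (Suc n)
  have "3 * (ternary_value b - ternary_value a)
      = ternary_value (\<lambda>k. b (Suc k)) - ternary_value (\<lambda>k. a (Suc k))"
    using ternary_value_rec[of a] ternary_value_rec[of b] Suc.prems by simp
  also have "\<dots> = (ternary_value (\<lambda>k. b (Suc n + k)) - ternary_value (\<lambda>k. a (Suc n + k))) / 3 ^ n"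
    using Suc.IH[of "\<lambda>k. a (Suc k)" "\<lambda>k. b (Suc k)"] Suc.prems by simp
  finally show ?case by (simp add: field_simps)
qed simp

text \<open>The digits before n agree, and so do those after n: one unfolding of the tails that
  start at n isolates the changed digit. Admissibility is not assumed because the lemma is also
  applied to image sequences, which may end in 2's.\<close>

lemma ternary_value_diff_digit:
  assumes "\<And>k. a k \<le> 2" "d \<le> 2"
  shows "ternary_value (a(n := d)) - ternary_value a = (real d - real (a n)) / 3 ^ Suc n"
proof -
  define b where "b = a(n := d)"
  have b2: "b k \<le> 2" for k using assms by (simp add: b_def)
  have "3 * ternary_value (\<lambda>k. b (n + k)) - 3 * ternary_value (\<lambda>k. a (n + k))
      = real d - real (a n)"
    using ternary_value_rec[of "\<lambda>k. b (n + k)", OF b2]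
      ternary_value_rec[of "\<lambda>k. a (n + k)", OF assms(1)]
    by (simp add: b_def)
  then have "ternary_value (\<lambda>k. b (n + k)) - ternary_value (\<lambda>k. a (n + k))
      = (real d - real (a n)) / 3"
    by simp
  moreover have "ternary_value b - ternary_value a
      = (ternary_value (\<lambda>k. b (n + k)) - ternary_value (\<lambda>k. a (n + k))) / 3 ^ n"
    by (rule ternary_value_diff_shift[OF assms(1) b2]) (simp add: b_def)
  ultimately have "ternary_value b - ternary_value a = (real d - real (a n)) / 3 / 3 ^ n"
    by (simp only:)
  then show ?thesis by (simp add: b_def)
qed

text \<open>A constant sequence is its own tail, so its value v satisfies 3v = d + v.\<close>

lemma ternary_value_const:
  assumes "d \<le> 2"
  shows "ternary_value (\<lambda>_. d) = real d / 2"
  using ternary_value_rec[of "\<lambda>_. d", OF assms] by linarith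

lemma admissible_digits_le_2:
  assumes "admissible_digits a"
  shows "a n \<le> 2"
proof -
  have "a n \<in> {0, 1, 2}" using assms by (simp add: admissible_digits_def)
  then show ?thesis by auto
qed

lemma \<phi>_le_2: "\<phi> d \<le> 2"
  by (simp add: \<phi>_def)

lemma admissible_digits_update:
  assumes a: "admissible_digits a" "\<not> (\<forall>k. a k = 2)" and d: "d \<le> 2"
  shows "admissible_digits (a(n := d))"
proof -
  have "(a(n := d)) k \<in> {0, 1, 2}" for k
    using d admissible_digits_le_2[OF a(1), of k] by auto
  moreover have "\<not> (\<exists>N. \<forall>k\<ge>N. (a(n := d)) k = 2)"
  proof
    assume "\<exists>N. \<forall>k\<ge>N. (a(n := d)) k = 2"
    then obtain N where N: "\<And>k. N \<le> k \<Longrightarrow> (a(n := d)) k = 2" by blast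
    \<comment> \<open>Beyond position n the update equals a, so a itself would end in 2's;
      admissibility would then make it the excluded all-2 sequence.\<close>
    have "a k = 2" if "max N (Suc n) \<le> k" for k
      using N[of k] that by simp
    with a show False unfolding admissible_digits_def by blast
  qed
  ultimately show ?thesis unfolding admissible_digits_def by blast
qed

text \<open>Numerator and denominator carry the same weight 1 / 3 ^ Suc n, which cancels. For d = a
  n both sides are 0 / 0 = 0.\<close>

lemma digit_swap_slope_update:
  assumes a: "admissible_digits a" "\<not> (\<forall>k. a k = 2)" and d: "d \<le> 2"
  shows "(digit_swap (ternary_value (a(n := d))) - digit_swap (ternary_value a))
      / (ternary_value (a(n := d)) - ternary_value a)
    = (real (\<phi> d) - real (\<phi> (a n))) / (real d - real (a n))"
proof -
  have "(\<lambda>k. \<phi> ((a(n := d)) k)) = (\<lambda>k. \<phi> (a k))(n := \<phi> d)" by auto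
  then have "digit_swap (ternary_value (a(n := d))) - digit_swap (ternary_value a)
      = (real (\<phi> d) - real (\<phi> (a n))) / 3 ^ Suc n"
    using ternary_value_diff_digit[of "\<lambda>k. \<phi> (a k)" "\<phi> d" n]
    by (simp add: digit_swap_ternary_value a(1) admissible_digits_update[OF a d] \<phi>_le_2)
  moreover have "ternary_value (a(n := d)) - ternary_value a = (real d - real (a n)) / 3 ^ Suc n"
    using admissible_digits_le_2[OF a(1)] d by (rule ternary_value_diff_digit)
  ultimately show ?thesis by simp
qed

text \<open>The slopes between the digits 0 and 1, 0 and 2, 1 and 2 are 2, 1/2 and -1. Those meeting
  at one digit differ by at least 3/2.\<close>

lemma \<phi>_slopes_apart:
  assumes "a \<le> 2"
  obtains d d' where "d \<le> 2" "d' \<le> 2" "d \<noteq> a" "d' \<noteq> a"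
    "3 / 2 \<le> \<bar>(real (\<phi> d) - real (\<phi> a)) / (real d - real a)
      - (real (\<phi> d') - real (\<phi> a)) / (real d' - real a)\<bar>"
proof -
  consider "a = 0" | "a = 1" | "a = 2" using assms by linarith
  then show thesis
  proof cases
    case 1 then show thesis by (intro that[of 1 2]) (auto simp: \<phi>_def)
  next
    case 2 then show thesis by (intro that[of 0 2]) (auto simp: \<phi>_def)
  next
    case 3 then show thesis by (intro that[of 0 1]) (auto simp: \<phi>_def)
  qed
qed

lemma digit_swap_not_differentiable_less_1:
  assumes a: "admissible_digits a" "\<not> (\<forall>k. a k = 2)"
  shows "\<not> digit_swap differentiable (at (ternary_value a) within {0..1})"
proof (rule not_differentiable_if_slopes_apart[of "3 / 2"])
  fix e :: real assume "0 < e"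
  then obtain n where n: "(1 / 3 :: real) ^ n < e"
    using real_arch_pow_inv[of e "1 / 3"] by auto
  have a2: "a k \<le> 2" for k by (rule admissible_digits_le_2[OF a(1)])
  \<comment> \<open>The pair depends on the digit a n and hence on e; the gap 3/2 does not.\<close>
  obtain d d' where d: "d \<le> 2" "d' \<le> 2" "d \<noteq> a n" "d' \<noteq> a n"
    and sep: "3 / 2 \<le> \<bar>(real (\<phi> d) - real (\<phi> (a n))) / (real d - real (a n))
      - (real (\<phi> d') - real (\<phi> (a n))) / (real d' - real (a n))\<bar>"
    using \<phi>_slopes_apart[OF a2[of n]] by blast
  have near: "ternary_value (a(n := c)) \<in> {0..1} - {ternary_value a} \<and>
      dist (ternary_value (a(n := c))) (ternary_value a) < e"
    if c: "c \<le> 2" "c \<noteq> a n" for c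
  proof -
    have diff: "ternary_value (a(n := c)) - ternary_value a = (real c - real (a n)) / 3 ^ Suc n"
      by (rule ternary_value_diff_digit[OF a2 c(1)])
    moreover have "ternary_value (a(n := c)) \<in> {0..1}"
      using ternary_value_nonneg[of "a(n := c)"] ternary_value_le_1[of "a(n := c)"] a2 c by simp
    \<comment> \<open>The generous bound 3 turns the distance estimate into 1 / 3 ^ n, which is
      below e.\<close>
    moreover have "\<bar>real c - real (a n)\<bar> / 3 ^ Suc n \<le> 3 / 3 ^ Suc n"
      using c a2[of n] by (intro divide_right_mono) auto
    ultimately show ?thesis using n c by (auto simp: dist_real_def power_divide)
  qed
  show "\<exists>y\<in>{0..1} - {ternary_value a}. \<exists>z\<in>{0..1} - {ternary_value a}.
      dist y (ternary_value a) < e \<and> dist z (ternary_value a) < e \<and>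
      3 / 2 \<le> \<bar>(digit_swap y - digit_swap (ternary_value a)) / (y - ternary_value a)
        - (digit_swap z - digit_swap (ternary_value a)) / (z - ternary_value a)\<bar>"
    using near[OF d(1,3)] near[OF d(2,4)] sep
    unfolding digit_swap_slope_update[OF a d(1), of n, symmetric]
      digit_swap_slope_update[OF a d(2), of n, symmetric]
    by blast
qed simp

lemma digit_swap_1: "digit_swap 1 = 1 / 2"
proof -
  have "digit_swap (ternary_value (\<lambda>_. 2)) = ternary_value (\<lambda>_. \<phi> 2)"
    by (rule digit_swap_ternary_value) (simp add: admissible_digits_def)
  then show ?thesis by (simp add: ternary_value_const \<phi>_def)
qed

text \<open>The digits of y are n twos, then d, then zeros; those of its image are n ones, then
  \<phi> d, then zeros. They are compared with 1 = 222... and its image 1/2 = 111..., so that only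
  the tails from n on contribute.\<close>

lemma digit_swap_near_1:
  fixes n d :: nat
  assumes d: "d \<le> 1"
  defines "y \<equiv> 1 - (1 - real d / 3) / 3 ^ n"
  shows "y \<in> {0..1}" "digit_swap y = 1 / 2 + (real (\<phi> d) / 3 - 1 / 2) / 3 ^ n"
proof -
  define b where "b k = (if k < n then 2 else if k = n then d else 0)" for k
  have b2: "b k \<le> 2" for k using d by (simp add: b_def)
  have "b k \<in> {0, 1, 2}" for k using b2[of k] by auto
  \<comment> \<open>The witness lies beyond n, among the zeros.\<close>
  moreover have "\<exists>k\<ge>N. b k \<noteq> 2" for N
    by (rule exI[of _ "N + n + 1"]) (simp add: b_def)
  then have "\<not> (\<exists>N. \<forall>k\<ge>N. b k = 2)" by blast
  ultimately have adm: "admissible_digits b" by (simp add: admissible_digits_def)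
  have tail: "ternary_value (\<lambda>k. c (n + k)) = real (c n) / 3"
    if c2: "\<And>k. c k \<le> 2" and c0: "\<And>k. n < k \<Longrightarrow> c k = 0" for c
  proof -
    have "3 * ternary_value (\<lambda>k. c (n + k)) = real (c n) + ternary_value (\<lambda>_. 0)"
      using ternary_value_rec[of "\<lambda>k. c (n + k)", OF c2] c0 by simp
    then show ?thesis using ternary_value_const[of 0] by simp
  qed
  have "ternary_value b - ternary_value (\<lambda>_. 2)
      = (ternary_value (\<lambda>k. b (n + k)) - ternary_value (\<lambda>_. 2)) / 3 ^ n"
    by (rule ternary_value_diff_shift[OF _ b2]) (auto simp: b_def)
  moreover have "ternary_value (\<lambda>k. b (n + k)) = real d / 3"
    using tail[of b, OF b2] by (simp add: b_def)
  moreover have "ternary_value (\<lambda>_. 2) = 1"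
    using ternary_value_const[of 2] by simp
  ultimately have val: "ternary_value b = y"
    by (simp add: y_def diff_divide_distrib)
  have "ternary_value (\<lambda>k. \<phi> (b k)) - ternary_value (\<lambda>_. 1)
      = (ternary_value (\<lambda>k. \<phi> (b (n + k))) - ternary_value (\<lambda>_. 1)) / 3 ^ n"
    by (rule ternary_value_diff_shift[OF _ \<phi>_le_2]) (auto simp: b_def \<phi>_def)
  moreover have "ternary_value (\<lambda>k. \<phi> (b (n + k))) = real (\<phi> d) / 3"
    using tail[of "\<lambda>k. \<phi> (b k)", OF \<phi>_le_2] by (simp add: b_def \<phi>_def)
  moreover have "ternary_value (\<lambda>_. 1) = 1 / 2"
    using ternary_value_const[of 1] by simp
  ultimately have "ternary_value (\<lambda>k. \<phi> (b k)) - 1 / 2 = (real (\<phi> d) / 3 - 1 / 2) / 3 ^ n"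
    by (simp only:)
  then have "ternary_value (\<lambda>k. \<phi> (b k)) = 1 / 2 + (real (\<phi> d) / 3 - 1 / 2) / 3 ^ n"
    by linarith
  then show "digit_swap y = 1 / 2 + (real (\<phi> d) / 3 - 1 / 2) / 3 ^ n"
    using digit_swap_ternary_value[OF adm] val by simp
  show "y \<in> {0..1}"
    using ternary_value_nonneg[of b, OF b2] ternary_value_le_1[of b, OF b2] val by simp
qed

lemma digit_swap_not_differentiable_1: "\<not> digit_swap differentiable (at 1 within {0..1})"
proof (rule not_differentiable_if_slopes_apart[of "3 / 4"])
  fix e :: real assume "0 < e"
  then obtain n where n: "(1 / 3 :: real) ^ n < e"
    using real_arch_pow_inv[of e "1 / 3"] by auto
  \<comment> \<open>These are the points of \<open>digit_swap_near_1\<close> for d = 0 and d =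
    1.\<close>
  define y z :: real where "y = 1 - 1 / 3 ^ n" and "z = 1 - (2 / 3) / 3 ^ n"
  have y: "y \<in> {0..1}" "digit_swap y - digit_swap 1 = - (1 / 2) / 3 ^ n"
    using digit_swap_near_1[of 0 n] by (simp_all add: y_def digit_swap_1 \<phi>_def)
  have z: "z \<in> {0..1}" "digit_swap z - digit_swap 1 = (1 / 6) / 3 ^ n"
    using digit_swap_near_1[of 1 n] by (simp_all add: z_def digit_swap_1 \<phi>_def)
  \<comment> \<open>Since z is nearer to 1 than y, the bound on 1 / 3 ^ n serves both
    points.\<close>
  have "(2 / 3) / 3 ^ n \<le> 1 / (3 ^ n :: real)" by (intro divide_right_mono) auto
  then have near: "y \<noteq> 1" "z \<noteq> 1" "dist y 1 < e" "dist z 1 < e"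
    using n by (auto simp: y_def z_def dist_real_def power_divide)
  have slope_y: "(digit_swap y - digit_swap 1) / (y - 1) = 1 / 2"
    unfolding y(2) by (simp add: y_def)
  have slope_z: "(digit_swap z - digit_swap 1) / (z - 1) = - 1 / 4"
    unfolding z(2) by (simp add: z_def)
  have "3 / 4 \<le> \<bar>(digit_swap y - digit_swap 1) / (y - 1)
      - (digit_swap z - digit_swap 1) / (z - 1)\<bar>"
    unfolding slope_y slope_z by simp
  with y(1) z(1) near
  show "\<exists>y\<in>{0..1} - {1}. \<exists>z\<in>{0..1} - {1}. dist y 1 < e \<and> dist z 1 < e \<and>
      3 / 4 \<le> \<bar>(digit_swap y - digit_swap 1) / (y - 1) - (digit_swap z - digit_swap 1) / (z - 1)\<bar>"
    by blast
qed simp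

theorem theorem3:
  shows "\<not> (\<exists>x\<in>{0..1::real}. digit_swap differentiable (at x within {0..1}))"
proof
  assume "\<exists>x\<in>{0..1::real}. digit_swap differentiable (at x within {0..1})"
  then obtain x where x: "x \<in> {0..1}" "digit_swap differentiable (at x within {0..1})" ..
  obtain a where a: "admissible_digits a" "ternary_value a = x"
    using ex1_ternary_digits[OF x(1)] by blast
  show False
  proof (cases "\<forall>k. a k = 2")
    case True
    then have "a = (\<lambda>_. 2)" by auto
    then have "x = 1" using a(2) ternary_value_const[of 2] by simp
    with x(2) digit_swap_not_differentiable_1 show False by simp
  next
    case False
    with a x(2) digit_swap_not_differentiable_less_1 show False by blast
  qed
qed

end
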